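(* Let $\mathrm{H}_2(x,y,z)=\mathrm{F}_{D}^{(3)}\left(\tfrac32;\tfrac12;2\,\middle|\,x,y,z\right)$ and $\mathrm{G}(x,y,z)=\mathrm{F}_{D}^{(3)}\left(\tfrac12;\tfrac12;1\,\middle|\,x,y,z\right)$. Then the identity $\mathrm{H}_2(x,y,z)=R\,\mathrm{G}(x,y,z)$ holds for $x=-1$, $z=-y$ and each of the following choices of $(y,R)$: 1. (order 3) $y=\frac13$, $R=2\sqrt3\,(2-\sqrt3)$; 2. (order 5) $y=\frac{\sqrt5-1}{2}$, $R=2\sqrt{\sqrt5-2}$; 3. (order 7) $y=\frac79$, $R=\frac{2(4-\sqrt7)}{\sqrt7}$; 4. (order 9) $y=\frac{\sqrt3}{2}$, $R=\frac{\sqrt2}{\sqrt[4]{3}}$; 5. (order 13) $y=\frac{5\sqrt{13}-1}{18}$, $R=\frac{2\sqrt{37\sqrt{13}-106}}{9}$; 6. (order 15) $y=\frac{3}{121}(21+8\sqrt5)$, $R=\frac{2(\sqrt3-3\sqrt5)(\sqrt5-4)}{3(1+\sqrt{15})}$; 7. (order 25) $y=\frac{4\sqrt5}{9}$, $R=\frac{2}{\sqrt[4]{5}}$; 8. (order 33) $y=\frac{16}{15\sqrt3-3\sqrt{11}}$, $R=\frac{\sqrt3\,(17-\sqrt{33})\sqrt[4]{43-5\sqrt{33}}}{2^{19/4}}$.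
   Context: Lauricella function with equal $b$-parameters: for real $\alpha,\beta,\gamma$ with $\gamma>\alpha>0$ and $x_1,x_2,x_3\in\mathbb{C}\setminus[1,\infty)$, $\mathrm{F}_{D}^{(3)}(\alpha;\beta;\gamma\,|\,x_1,x_2,x_3)$ denotes the Lauricella function with parameters $b_1=b_2=b_3=\beta$, given by the integral representation $$\mathrm{F}_{D}^{(3)}(\alpha;\beta;\gamma\,|\,x_1,x_2,x_3)=\frac{\Gamma(\gamma)}{\Gamma(\alpha)\Gamma(\gamma-\alpha)}\int_0^1\frac{u^{\alpha-1}(1-u)^{\gamma-\alpha-1}}{(1-x_1u)^{\beta}(1-x_2u)^{\beta}(1-x_3u)^{\beta}}\,\mathrm{d}u$$ (principal branches). It is the analytic continuation of the series $\sum_{m_1,m_2,m_3\ge0}\frac{(\alpha)_{m_1+m_2+m_3}(\beta)_{m_1}(\beta)_{m_2}(\beta)_{m_3}}{(\gamma)_{m_1+m_2+m_3}\,m_1!\,m_2!\,m_3!}x_1^{m_1}x_2^{m_2}x_3^{m_3}$, which converges for $|x_j|<1$, where $(\lambda)_m=\lambda(\lambda+1)\cdots(\lambda+m-1)$. The "order" attached to each case is only a label (it is the integer $n$ of the $n$-th elliptic singular modulus). *)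

theory Defs
  imports "HOL-Analysis.Analysis"
begin

(* Only meaningful for c > a > 0 and x1, x2, x3 outside the ray [1, oo); there the
   integrand is absolutely integrable and the bases 1 - xj u stay off the branch cut of
   the principal power. *)
definition lauricella_FD3 ::
    "real \<Rightarrow> real \<Rightarrow> real \<Rightarrow> complex \<Rightarrow> complex \<Rightarrow> complex \<Rightarrow> complex" where
  "lauricella_FD3 a b c x1 x2 x3 =
     of_real (Gamma c / (Gamma a * Gamma (c - a))) *
     (LINT u:{0<..<1}|lborel.
        of_real (u powr (a - 1) * (1 - u) powr (c - a - 1)) /
        ((1 - x1 * of_real u) powr of_real b *
         (1 - x2 * of_real u) powr of_real b *
         (1 - x3 * of_real u) powr of_real b))"

definition H2 :: "complex \<Rightarrow> complex \<Rightarrow> complex \<Rightarrow> complex" where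
  "H2 x y z = lauricella_FD3 (3/2) (1/2) 2 x y z"

definition G :: "complex \<Rightarrow> complex \<Rightarrow> complex \<Rightarrow> complex" where
  "G x y z = lauricella_FD3 (1/2) (1/2) 1 x y z"

end

theory Submission
  imports Defs "HOL-Computational_Algebra.Polynomial"
begin

text \<open>
  For $x = -1$, $z = -y$ both functions are integrals against
  $u^{\pm 1/2} / \sqrt{(1-u^2)(1-y^2u^2)}$ on $(0,1)$. The two substitutions
  $t = \sqrt y\,u + 1/(\sqrt y\,u) \mp 2$ turn the combinations $\pi(G \pm \sqrt y H_2/2)$ of them into complete
  elliptic integrals of the curves $w^2 = t(t^2 \pm 4t - c)$ with $c = y + 1/y - 2$. For
  the listed $y$ these curves have complex multiplication by $\sqrt{-n}$, where $n$ is the order: there is a rational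
  map $S(t) = t N(t)^2/(m D(t)^2)$ of degree $n$ (or a composite of two such maps of
  prime degrees) carrying one differential to a multiple of the other. As $D$ has no root on
  $[0,\infty)$, $S$ maps the half-line of one integral bijectively onto that of the other, so
  that the integrals are in ratio $\sqrt n$. This is a linear equation between $G$ and $H_2$, namely
  $H_2\sqrt y\,(\sqrt n+1) = 2(\sqrt n-1)\,G$.
\<close>

section \<open>Polynomials over biquadratic fields\<close>

text \<open>
  The tuple $(a,b,c,d)$ stands for $a + br + cs + drs$ with $r^2 = p$ and $s^2 = q$; a
  list of tuples is a polynomial, constant coefficient first. In this form the identity that
  characterises an isogeny becomes an executable check over the integers.
\<close>

type_synonym quad = "int \<times> int \<times> int \<times> int"

fun qadd :: "quad \<Rightarrow> quad \<Rightarrow> quad" where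
  "qadd (a, b, c, d) (a', b', c', d') = (a + a', b + b', c + c', d + d')"

fun qscale :: "int \<Rightarrow> quad \<Rightarrow> quad" where
  "qscale k (a, b, c, d) = (k * a, k * b, k * c, k * d)"

fun qmul :: "int \<Rightarrow> int \<Rightarrow> quad \<Rightarrow> quad \<Rightarrow> quad" where
  "qmul p q (a, b, c, d) (a', b', c', d') =
    (a * a' + p * (b * b') + q * (c * c' + p * (d * d')),
     a * b' + b * a' + q * (c * d' + d * c'),
     a * c' + c * a' + p * (b * d' + d * b'),
     a * d' + d * a' + b * c' + c * b')"

fun ladd :: "quad list \<Rightarrow> quad list \<Rightarrow> quad list" where
  "ladd [] ys = ys"
| "ladd xs [] = xs"
| "ladd (x # xs) (y # ys) = qadd x y # ladd xs ys"

definition lscale :: "int \<Rightarrow> quad list \<Rightarrow> quad list" where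
  "lscale k = map (qscale k)"

fun lmul :: "int \<Rightarrow> int \<Rightarrow> quad list \<Rightarrow> quad list \<Rightarrow> quad list" where
  "lmul p q [] ys = []"
| "lmul p q (x # xs) ys = ladd (map (qmul p q x) ys) ((0, 0, 0, 0) # lmul p q xs ys)"

text \<open>Multiplies the coefficient of \<open>t^j\<close> by \<open>i + j\<close>. At
  \<open>i = 0\<close> this is the operator \<open>t d/dt\<close>, which needs no shift of the list;
  a general \<open>i\<close> carries the index through the recursion.\<close>

fun lxderiv :: "int \<Rightarrow> quad list \<Rightarrow> quad list" where
  "lxderiv i [] = []"
| "lxderiv i (x # xs) = qscale i x # lxderiv (i + 1) xs"

text \<open>\<open>X\<close> and \<open>D2\<close> encode \<open>t N^2\<close> and
  \<open>D^2\<close>. Lists are not normalised, so the test is that every coefficient of the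
  difference is the zero tuple. A zero tuple evaluates to 0 for all \<open>r\<close> and
  \<open>s\<close>, so rational examples can be run with \<open>p = q = 1\<close>.\<close>

definition isogeny_check ::
    "int \<Rightarrow> int \<Rightarrow> int \<Rightarrow> quad \<Rightarrow> quad \<Rightarrow> quad \<Rightarrow> quad \<Rightarrow> quad list \<Rightarrow> quad list \<Rightarrow> bool" where
  "isogeny_check p q m a b a' b' N D \<longleftrightarrow>
    (let C = ladd (lmul p q N D)
               (lscale 2 (ladd (lmul p q (lxderiv 0 N) D) (lscale (- 1) (lmul p q N (lxderiv 0 D)))));
         X = (0, 0, 0, 0) # lmul p q N N;
         D2 = lmul p q D D;
         L = ladd (lmul p q X (ladd X (lscale m (map (qmul p q a') D2))))
               (lscale (m\<^sup>2) (map (qmul p q b') (lmul p q D2 D2)));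
         R = lmul p q [b, a, (1, 0, 0, 0)] (lmul p q C C)
     in list_all ((=) (0, 0, 0, 0)) (ladd L (lscale (- 1) R)))"

section \<open>Evaluation of coefficient lists at real square roots\<close>

fun qval :: "real \<Rightarrow> real \<Rightarrow> quad \<Rightarrow> real" where
  "qval r s (a, b, c, d) = of_int a + of_int b * r + of_int c * s + of_int d * (r * s)"

fun lpoly :: "real \<Rightarrow> real \<Rightarrow> quad list \<Rightarrow> real poly" where
  "lpoly r s [] = 0"
| "lpoly r s (x # xs) = pCons (qval r s x) (lpoly r s xs)"

lemma qval_add: "qval r s (qadd x y) = qval r s x + qval r s y"
  by (cases x; cases y) (simp add: algebra_simps)

lemma qval_scale: "qval r s (qscale k x) = of_int k * qval r s x"
  by (cases x) (simp add: algebra_simps)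

lemma qval_mul:
  assumes "r\<^sup>2 = of_int p" "s\<^sup>2 = of_int q"
  shows "qval r s (qmul p q x y) = qval r s x * qval r s y"
proof -
  obtain a b c d a' b' c' d' where "x = (a, b, c, d)" "y = (a', b', c', d')"
    by (metis prod_cases4)
  then show ?thesis
    by (simp add: assms[symmetric]) (simp add: algebra_simps power2_eq_square)
qed

lemma lpoly_ladd: "lpoly r s (ladd xs ys) = lpoly r s xs + lpoly r s ys"
  by (induction xs ys rule: ladd.induct) (simp_all add: qval_add)

lemma lpoly_lscale: "lpoly r s (lscale k xs) = smult (of_int k) (lpoly r s xs)"
  by (induction xs) (simp_all add: lscale_def qval_scale)

lemma lpoly_map_qmul:
  assumes "r\<^sup>2 = of_int p" "s\<^sup>2 = of_int q"
  shows "lpoly r s (map (qmul p q x) ys) = smult (qval r s x) (lpoly r s ys)"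
  by (induction ys) (simp_all add: qval_mul[OF assms])

lemma lpoly_lmul:
  assumes "r\<^sup>2 = of_int p" "s\<^sup>2 = of_int q"
  shows "lpoly r s (lmul p q xs ys) = lpoly r s xs * lpoly r s ys"
  by (induction xs) (simp_all add: lpoly_ladd lpoly_map_qmul[OF assms])

lemma lpoly_lxderiv:
  "lpoly r s (lxderiv i xs) = smult (of_int i) (lpoly r s xs) + pCons 0 (pderiv (lpoly r s xs))"
  by (induction xs arbitrary: i) (simp_all add: qval_scale pderiv_pCons smult_add_left)

lemma lpoly_eq_0: "list_all ((=) (0, 0, 0, 0)) xs \<Longrightarrow> lpoly r s xs = 0"
  by (induction xs) auto

text \<open>With \<open>S = t N\<^sup>2 / (m D\<^sup>2)\<close> and cofactor \<open>C\<close>, one has \<open>S' = N C / (m D\<^sup>3)\<close>.\<close>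

definition isogeny_cofactor :: "real poly \<Rightarrow> real poly \<Rightarrow> real poly" where
  "isogeny_cofactor N D =
    N * D + smult 2 (pCons 0 (pderiv N) * D - N * pCons 0 (pderiv D))"

text \<open>This is \<open>m\<^sup>2 D\<^sup>4 (S\<^sup>2 + a' S + b') = (t\<^sup>2 + a t + b) C\<^sup>2\<close> cleared of denominators.\<close>

definition isogeny :: "real \<Rightarrow> real \<Rightarrow> real \<Rightarrow> real \<Rightarrow> real \<Rightarrow> real poly \<Rightarrow> real poly \<Rightarrow> bool" where
  "isogeny m a b a' b' N D \<longleftrightarrow> (\<forall>x.
    (x * (poly N x)\<^sup>2)\<^sup>2 + m * a' * (x * (poly N x)\<^sup>2) * (poly D x)\<^sup>2 + m\<^sup>2 * b' * (poly D x) ^ 4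
    = (x\<^sup>2 + a * x + b) * (poly (isogeny_cofactor N D) x)\<^sup>2)"

text \<open>\<open>lpoly\<close> respects sums, scalings, products and \<open>t d/dt\<close>, so
  vanishing coefficient tuples become a polynomial identity, which is then read at every real
  \<open>x\<close>.\<close>

lemma isogeny_check_sound:
  assumes "isogeny_check p q m a b a' b' N D" "r\<^sup>2 = of_int p" "s\<^sup>2 = of_int q"
  shows "isogeny (of_int m) (qval r s a) (qval r s b) (qval r s a') (qval r s b')
    (lpoly r s N) (lpoly r s D)"
proof -
  note hom = lpoly_ladd lpoly_lscale lpoly_map_qmul[OF assms(2,3)] lpoly_lmul[OF assms(2,3)] lpoly_lxderiv
  define C where "C = ladd (lmul p q N D)
    (lscale 2 (ladd (lmul p q (lxderiv 0 N) D) (lscale (- 1) (lmul p q N (lxderiv 0 D)))))"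
  have C: "lpoly r s C = isogeny_cofactor (lpoly r s N) (lpoly r s D)"
    by (simp add: C_def hom isogeny_cofactor_def)
  have "poly (isogeny_cofactor (lpoly r s N) (lpoly r s D)) x = poly (lpoly r s C) x" for x
    by (simp add: C)
  then show ?thesis
    using lpoly_eq_0[OF assms(1)[unfolded isogeny_check_def Let_def, folded C_def], of r s]
    unfolding isogeny_def poly_eq_poly_eq_iff[symmetric] fun_eq_iff
    by (simp add: hom power2_eq_square power4_eq_xxxx algebra_simps)
qed

section \<open>Transformation of elliptic integrals\<close>

text \<open>The largest root of $t(t^2 + at + b)$ when $b < 0$.\<close>

definition cubic_root :: "real \<Rightarrow> real \<Rightarrow> real" where
  "cubic_root a b = (sqrt (a\<^sup>2 - 4 * b) - a) / 2"

definition elliptic_integrand :: "real \<Rightarrow> real \<Rightarrow> real \<Rightarrow> real" where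
  "elliptic_integrand a b t = 1 / sqrt (t * (t\<^sup>2 + a * t + b))"

section \<open>Signs of the cubic and growth of the rational map\<close>

lemma quadratic_factor:
  assumes "b < 0"
  shows "t\<^sup>2 + a * t + b = (t - cubic_root a b) * (t + (a + cubic_root a b))"
    and "cubic_root a b > 0" and "a + cubic_root a b > 0"
proof -
  have sq: "(sqrt (a\<^sup>2 - 4 * b))\<^sup>2 = a\<^sup>2 - 4 * b"
    using assms zero_le_power2[of a] by (intro real_sqrt_pow2) linarith
  then show "t\<^sup>2 + a * t + b = (t - cubic_root a b) * (t + (a + cubic_root a b))"
    unfolding cubic_root_def by (simp add: field_simps power2_eq_square)
  have "\<bar>a\<bar> < sqrt (a\<^sup>2 - 4 * b)"
    using assms by (intro real_less_rsqrt) simp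
  then show "cubic_root a b > 0" "a + cubic_root a b > 0"
    unfolding cubic_root_def by (auto simp: field_simps)
qed

text \<open>For \<open>t > 0\<close> the factor \<open>t + (a + cubic_root a b)\<close> is positive,
  so the quadratic has the sign of \<open>t - cubic_root a b\<close>.\<close>

lemma quadratic_nonneg_iff:
  assumes "b < 0" "t > 0"
  shows "t\<^sup>2 + a * t + b \<ge> 0 \<longleftrightarrow> cubic_root a b \<le> t"
    and "t\<^sup>2 + a * t + b = 0 \<longleftrightarrow> t = cubic_root a b"
    and "t\<^sup>2 + a * t + b > 0 \<longleftrightarrow> cubic_root a b < t"
  using quadratic_factor(1)[OF assms(1), of t a] quadratic_factor(2,3)[OF assms(1), of a] assms(2)
  by (auto simp: zero_le_mult_iff zero_less_mult_iff)

text \<open>Equal degrees make \<open>p^2 / (m q^2)\<close> tend to a positive constant, and the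
  remaining factor \<open>t\<close> diverges.\<close>

lemma filterlim_poly_ratio_at_top:
  fixes p q :: "real poly"
  assumes "degree p = degree q" "p \<noteq> 0" "q \<noteq> 0" "m > 0"
  shows "filterlim (\<lambda>t. t * (poly p t)\<^sup>2 / (m * (poly q t)\<^sup>2)) at_top at_top"
proof -
  have lim: "((\<lambda>x. poly p x / x ^ degree p) \<longlongrightarrow> lead_coeff p) at_top" for p :: "real poly"
    using poly_divide_tendsto_aux[of p] at_top_le_at_infinity by (rule tendsto_mono[rotated])
  have "((\<lambda>t. (poly p t / t ^ degree p / (poly q t / t ^ degree q))\<^sup>2 / m) \<longlongrightarrow>
      (lead_coeff p / lead_coeff q)\<^sup>2 / m) at_top"
    using assms by (intro tendsto_intros lim) auto
  moreover have "\<forall>\<^sub>F t in at_top. (poly p t / t ^ degree p / (poly q t / t ^ degree q))\<^sup>2 / m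
      = (poly p t)\<^sup>2 / (m * (poly q t)\<^sup>2)"
    using eventually_gt_at_top[of 0]
    by eventually_elim (simp add: assms(1) power_divide field_simps)
  ultimately have "((\<lambda>t. (poly p t)\<^sup>2 / (m * (poly q t)\<^sup>2)) \<longlongrightarrow>
      (lead_coeff p / lead_coeff q)\<^sup>2 / m) at_top"
    by (rule Lim_transform_eventually)
  moreover have "(lead_coeff p / lead_coeff q)\<^sup>2 / m > 0"
    using assms(2-4) leading_coeff_0_iff[of p] leading_coeff_0_iff[of q]
    by (intro divide_pos_pos) (simp_all del: leading_coeff_0_iff)
  ultimately have "filterlim (\<lambda>t. (poly p t)\<^sup>2 / (m * (poly q t)\<^sup>2) * t) at_top at_top"
    by (rule filterlim_tendsto_pos_mult_at_top) (rule filterlim_ident)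
  then show ?thesis
    by (simp add: mult.commute)
qed

text \<open>The isogeny identity amounts to
  \<open>m g (g^2 + a' g + b') = g'^2 t (t^2 + a t + b)\<close>, whose square root relates the
  integrands. It also keeps \<open>g\<close> at or above the target root, with equality only at the
  endpoint and at critical points. Once interior critical points are excluded, Rolle gives
  injectivity, and growth with the intermediate value theorem gives surjectivity.\<close>

lemma isogeny_map:
  fixes N D :: "real poly"
  assumes iso: "isogeny m a b a' b' N D" and m: "m > 0" and b: "b < 0" and b': "b' < 0"
    and D: "\<And>t. t \<ge> 0 \<Longrightarrow> poly D t > 0" and deg: "degree N = degree D"
  defines "g \<equiv> \<lambda>t. t * (poly N t)\<^sup>2 / (m * (poly D t)\<^sup>2)"
    and "g' \<equiv> \<lambda>t. poly N t * poly (isogeny_cofactor N D) t / (m * poly D t ^ 3)"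
  shows "\<And>t. t > cubic_root a b \<Longrightarrow> (g has_field_derivative g' t) (at t)"
    and "\<And>t. t > cubic_root a b \<Longrightarrow> 
           \<bar>g' t\<bar> * elliptic_integrand a' b' (g t) = sqrt m * elliptic_integrand a b t"
    and "inj_on g {cubic_root a b<..}"
    and "g ` {cubic_root a b<..} = {cubic_root a' b'<..}"
proof -
  define C where "C = isogeny_cofactor N D"
  define T where "T = cubic_root a b"
  define S where "S = cubic_root a' b'"
  have T: "T > 0"
    using quadratic_factor(2)[OF b] by (simp add: T_def)
  have D0: "poly D t > 0" if "t \<ge> T" for t
    using D T that by simp
  have quad: "(m\<^sup>2 * poly D t ^ 4) * ((g t)\<^sup>2 + a' * g t + b') = (t\<^sup>2 + a * t + b) * (poly C t)\<^sup>2"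
    if "t \<ge> 0" for t
  proof -
    have "(m\<^sup>2 * poly D t ^ 4) * ((g t)\<^sup>2 + a' * g t + b')
       = (t * (poly N t)\<^sup>2)\<^sup>2 + m * a' * (t * (poly N t)\<^sup>2) * (poly D t)\<^sup>2 + m\<^sup>2 * b' * (poly D t) ^ 4"
      using D[OF that] m unfolding g_def
      by (simp add: field_simps power2_eq_square power4_eq_xxxx)
    then show ?thesis
      using iso by (simp add: isogeny_def C_def)
  qed
  have mD: "m\<^sup>2 * poly D t ^ 4 > 0" if "t \<ge> 0" for t
    using D[OF that] m by simp
  have quad_ge: "(g t)\<^sup>2 + a' * g t + b' \<ge> 0" if "t \<ge> T" for t
  proof -
    have "(t\<^sup>2 + a * t + b) * (poly C t)\<^sup>2 \<ge> 0"
      using quadratic_nonneg_iff(1)[OF b, of t a] that T by (simp add: T_def)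
    then have "(m\<^sup>2 * poly D t ^ 4) * ((g t)\<^sup>2 + a' * g t + b') \<ge> 0"
      using quad[of t] that T by simp
    moreover have "m\<^sup>2 * poly D t ^ 4 > 0"
      using mD[of t] that T by simp
    ultimately show ?thesis
      by (metis mult_pos_neg not_less)
  qed
  \<comment> \<open>At a zero of \<open>N\<close> one has \<open>g t = 0\<close>, where the target
    quadratic equals \<open>b' < 0\<close>, against \<open>quad_ge\<close>.\<close>
  have N0: "poly N t \<noteq> 0" if "t \<ge> T" for t
    using quad_ge[OF that] b' by (auto simp: g_def)
  have g0: "g t > 0" if "t \<ge> T" for t
    using N0[OF that] D0[OF that] T m that by (simp add: g_def)
  have gS: "g t \<ge> S" if "t \<ge> T" for t
    using quadratic_nonneg_iff(1)[OF b' g0[OF that], of a'] quad_ge[OF that] by (simp add: S_def)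
  \<comment> \<open>By \<open>quad\<close>, \<open>g\<close> meets the target root exactly where
    \<open>t^2 + a t + b\<close> or the cofactor vanishes; zeros of the cofactor are the critical
    points of \<open>g\<close>.\<close>
  have gS_eq: "g t = S \<longleftrightarrow> t = T \<or> poly C t = 0" if "t \<ge> T" for t
  proof -
    have "g t = S \<longleftrightarrow> (m\<^sup>2 * poly D t ^ 4) * ((g t)\<^sup>2 + a' * g t + b') = 0"
      using quadratic_nonneg_iff(2)[OF b' g0[OF that], of a'] D0[OF that] m by (simp add: S_def)
    also have "\<dots> \<longleftrightarrow> t = T \<or> poly C t = 0"
      using quad[of t] quadratic_nonneg_iff(2)[OF b, of t a] that T by (simp add: T_def)
    finally show ?thesis .
  qed
  have deriv: "(g has_field_derivative g' t) (at t)" if "t \<ge> T" for t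
  proof -
    let ?n = "poly N t" and ?n' = "poly (pderiv N) t" and ?d = "poly D t" and ?d' = "poly (pderiv D) t"
    have "((\<lambda>t. t * (poly N t)\<^sup>2) has_field_derivative ?n\<^sup>2 + 2 * ?n * ?n' * t) (at t)"
      "((\<lambda>t. m * (poly D t)\<^sup>2) has_field_derivative m * (2 * ?d * ?d')) (at t)"
      by (auto intro!: derivative_eq_intros)
    from DERIV_divide[OF this]
    have "(g has_field_derivative
        ((?n\<^sup>2 + 2 * ?n * ?n' * t) * (m * ?d\<^sup>2) - t * ?n\<^sup>2 * (m * (2 * ?d * ?d'))) / (m * ?d\<^sup>2 * (m * ?d\<^sup>2))) (at t)"
      using D0[OF that] m unfolding g_def by simp
    moreover have "((n\<^sup>2 + 2 * n * n' * t) * (m * d\<^sup>2) - t * n\<^sup>2 * (m * (2 * d * d'))) / (m * d\<^sup>2 * (m * d\<^sup>2))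
        = n * (n * d + 2 * (t * n' * d - n * (t * d'))) / (m * d ^ 3)" if "d \<noteq> 0" for n n' d d' :: real
      using that m by (simp add: divide_simps) algebra
    moreover have "poly (isogeny_cofactor N D) t = ?n * ?d + 2 * (t * ?n' * ?d - ?n * (t * ?d'))"
      by (simp add: isogeny_cofactor_def algebra_simps)
    ultimately show ?thesis
      using D0[OF that] unfolding g'_def by simp
  qed
  have g'0: "g' t = 0 \<longleftrightarrow> poly C t = 0" if "t \<ge> T" for t
    using N0[OF that] D0[OF that] m by (simp add: g'_def C_def)
  have cont: "continuous_on {T..u} g" for u
    using deriv by (intro continuous_at_imp_continuous_on ballI DERIV_isCont) auto
  \<comment> \<open>At \<open>t = 0\<close> the left side of \<open>quad\<close> is
    \<open>m^2 D(0)^4 b'\<close>, which is negative. A nonzero \<open>C\<close> has only finitely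
    many roots.\<close>
  have C_nz: "C \<noteq> 0"
  proof
    assume "C = 0"
    then show False
      using quad[of 0] D[of 0] m b' by (simp add: g_def)
  qed
  \<comment> \<open>Critical points of \<open>g\<close> lie at its minimal level \<open>S\<close>, so between \<open>T\<close> and a critical
      point \<open>g\<close> would have no interior maximum above \<open>S\<close> and hence be constant.\<close>
  have C0: "poly C t \<noteq> 0" if "t > T" for t
  proof
    assume Ct: "poly C t = 0"
    obtain u where u: "u \<in> {T..t}" "\<And>v. v \<in> {T..t} \<Longrightarrow> g v \<le> g u"
      using continuous_attains_sup[of "{T..t}" g] cont \<open>t > T\<close> by auto
    have "g u = S"
    proof (cases "u = T \<or> u = t")
      case True
      then show ?thesis using gS_eq \<open>t > T\<close> Ct by auto
    next
      case False
      then have "T < u" "u < t" using u by auto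
      moreover have "\<forall>v. \<bar>u - v\<bar> < min (u - T) (t - u) \<longrightarrow> g v \<le> g u"
        using u(2) by (auto simp: abs_if split: if_splits)
      ultimately have "g' u = 0"
        using DERIV_local_max[OF deriv[of u], of "min (u - T) (t - u)"] by auto
      then show ?thesis using g'0 gS_eq \<open>T < u\<close> by auto
    qed
    then have "poly C v = 0" if "v \<in> {T<..<t}" for v
      using gS_eq[of v] gS[of v] u(2)[of v] that by auto
    then have "{T<..<t} \<subseteq> {v. poly C v = 0}"
      by auto
    then show False
      using poly_roots_finite[OF C_nz] \<open>t > T\<close> finite_subset infinite_Ioo by blast
  qed
  show "(g has_field_derivative g' t) (at t)" if "t > cubic_root a b" for t
    using deriv that by (simp add: T_def)
  show "\<bar>g' t\<bar> * elliptic_integrand a' b' (g t) = sqrt m * elliptic_integrand a b t"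
    if "t > cubic_root a b" for t
  proof -
    have t: "t > T" using that by (simp add: T_def)
    have pos: "t * (t\<^sup>2 + a * t + b) > 0"
      using quadratic_nonneg_iff(3)[OF b, of t a] t T by (simp add: T_def)
    have nz: "m\<^sup>2 * poly D t ^ 4 \<noteq> 0"
      using D0[of t] m t by simp
    have alg: "t * n\<^sup>2 / (m * d\<^sup>2) * (k * c\<^sup>2) = m\<^sup>2 * d ^ 4 * ((n * c / (m * d ^ 3))\<^sup>2 * (t * k) / m)"
      if "d \<noteq> 0" for n c d k :: real
      using that m by (simp add: divide_simps)
    have "(m\<^sup>2 * poly D t ^ 4) * (g t * ((g t)\<^sup>2 + a' * g t + b')) = g t * ((t\<^sup>2 + a * t + b) * (poly C t)\<^sup>2)"
      using quad[of t] t T by simp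
    also have "\<dots> = (m\<^sup>2 * poly D t ^ 4) * ((g' t)\<^sup>2 * (t * (t\<^sup>2 + a * t + b)) / m)"
      unfolding g_def g'_def C_def using alg[of "poly D t"] D0[of t] t by simp
    finally have "g t * ((g t)\<^sup>2 + a' * g t + b') = (g' t)\<^sup>2 * (t * (t\<^sup>2 + a * t + b)) / m"
      by (rule mult_left_cancel[OF nz, THEN iffD1])
    then have "elliptic_integrand a' b' (g t) = sqrt m / (\<bar>g' t\<bar> * sqrt (t * (t\<^sup>2 + a * t + b)))"
      by (simp add: elliptic_integrand_def real_sqrt_divide real_sqrt_mult)
    \<comment> \<open>Beyond \<open>T\<close> the cofactor has no zero, so \<open>g' t\<close> is
      nonzero and cancels.\<close>
    then show ?thesis
      using g'0[of t] C0[of t] t pos by (simp add: elliptic_integrand_def)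
  qed
  have neq: "g s \<noteq> g t" if "T < s" "s < t" for s t
  proof
    assume eq: "g s = g t"
    have cont': "continuous_on {s..t} g"
      by (rule continuous_on_subset[OF cont[of t]]) (use that in auto)
    have "g differentiable (at x)" if "s < x" for x
      using deriv[of x] \<open>T < s\<close> that by (auto simp: real_differentiable_def intro!: exI)
    then obtain z where "s < z" "z < t" "(g has_field_derivative 0) (at z)"
      using Rolle[OF \<open>s < t\<close> eq cont'] by auto
    then have "g' z = 0"
      using DERIV_unique[OF deriv[of z]] that by simp
    then show False
      using g'0[of z] C0[of z] that \<open>s < z\<close> by simp
  qed
  show "inj_on g {cubic_root a b<..}"
    unfolding T_def[symmetric] by (rule inj_onI) (metis neq greaterThan_iff linorder_neqE_linordered_idom)
  have "g t > S" if "t > T" for t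
    using gS[of t] gS_eq[of t] C0[of t] that by force
  moreover have "v \<in> g ` {T<..}" if v: "v > S" for v
  proof -
    have "D \<noteq> 0" "N \<noteq> 0"
      using D[of 0] N0[of T] by auto
    then have "filterlim g at_top at_top"
      unfolding g_def by (intro filterlim_poly_ratio_at_top deg m)
    then have "\<forall>\<^sub>F t in at_top. g t \<ge> v \<and> t \<ge> T"
      by (intro eventually_conj eventually_ge_at_top) (simp add: filterlim_at_top)
    then obtain u where u: "g u \<ge> v" "u \<ge> T"
      by (auto simp: eventually_at_top_linorder)
    \<comment> \<open>\<open>g T = S\<close> by \<open>gS_eq\<close>, so \<open>v\<close> lies
      between the values of \<open>g\<close> at \<open>T\<close> and at \<open>u\<close>.\<close>
    then obtain t where "T \<le> t" "t \<le> u" "g t = v"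
      using IVT'[of g T v u] gS_eq[of T] v cont by auto
    then show ?thesis
      using gS_eq[of T] v by (intro image_eqI[of _ _ t]) (auto simp: less_le)
  qed
  ultimately show "g ` {cubic_root a b<..} = {cubic_root a' b'<..}"
    unfolding T_def[symmetric] S_def[symmetric] by auto
qed

section \<open>Elliptic integrals under an isogeny\<close>

definition elliptic_integral :: "real \<Rightarrow> real \<Rightarrow> real" where
  "elliptic_integral a b = integral {cubic_root a b<..} (elliptic_integrand a b)"

text \<open>Integrability is transported together with the value of the integral, so that isogenies
  can be composed; on the first curve it comes from the weight on (0,1).\<close>

definition elliptic_integrable :: "real \<Rightarrow> real \<Rightarrow> bool" where
  "elliptic_integrable a b \<longleftrightarrow>
    elliptic_integrand a b absolutely_integrable_on {cubic_root a b<..}"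

lemma elliptic_integral_isogeny:
  fixes N D :: "real poly"
  assumes "isogeny m a b a' b' N D" "m > 0" "b < 0" "b' < 0"
    and "\<And>t. t \<ge> 0 \<Longrightarrow> poly D t > 0" "degree N = degree D" "elliptic_integrable a b"
  shows "elliptic_integrable a' b' \<and> elliptic_integral a' b' = sqrt m * elliptic_integral a b"
proof -
  note map = isogeny_map[OF assms(1-6)]
  define g where "g = (\<lambda>t. t * (poly N t)\<^sup>2 / (m * (poly D t)\<^sup>2))"
  define g' where "g' = (\<lambda>t. poly N t * poly (isogeny_cofactor N D) t / (m * poly D t ^ 3))"
  let ?A = "{cubic_root a b<..}"
  have eq: "\<bar>g' t\<bar> * elliptic_integrand a' b' (g t) = sqrt m * elliptic_integrand a b t" if "t \<in> ?A" for t
    using map(2)[of t] that by (simp add: g_def g'_def)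
  have "(\<lambda>t. sqrt m * elliptic_integrand a b t) absolutely_integrable_on ?A"
    using assms(7) unfolding elliptic_integrable_def by (rule set_integrable_mult_right)
  then have "(\<lambda>t. \<bar>g' t\<bar> * elliptic_integrand a' b' (g t)) absolutely_integrable_on ?A"
    by (subst set_integrable_cong[OF refl refl eq]) auto
  moreover have "integral ?A (\<lambda>t. \<bar>g' t\<bar> * elliptic_integrand a' b' (g t))
      = sqrt m * elliptic_integral a b"
    by (subst integral_cong[OF eq]) (auto simp: elliptic_integral_def)
  moreover have "?A \<in> sets lebesgue" by simp
  moreover have "(g has_field_derivative g' t) (at t within ?A)" if "t \<in> ?A" for t
    using map(1)[of t] that by (auto simp: g_def g'_def intro: has_field_derivative_at_within)
  moreover have "inj_on g ?A" "g ` ?A = {cubic_root a' b'<..}"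
    using map(3,4) by (simp_all add: g_def)
  ultimately show ?thesis
    using has_absolute_integral_change_of_variables_1'[of ?A g g' "elliptic_integrand a' b'"
        "sqrt m * elliptic_integral a b"]
    by (simp add: elliptic_integral_def elliptic_integrable_def)
qed

lemma lpoly_degree:
  assumes "l \<noteq> []" "qval r s (last l) \<noteq> 0"
  shows "lpoly r s l \<noteq> 0 \<and> degree (lpoly r s l) = length l - 1"
  using assms by (induction l) (auto split: if_splits)

lemma lpoly_pos:
  assumes "l \<noteq> []" "list_all (\<lambda>x. qval r s x > 0) l" "t \<ge> 0"
  shows "poly (lpoly r s l) t > 0"
  using assms
proof (induction l)
  case (Cons x l)
  then show ?case
    by (cases "l = []") (auto intro: add_pos_nonneg less_imp_le)
qed auto

text \<open>Replaces the analytic hypotheses by conditions on coefficients: positive coefficients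
  make \<open>D\<close> positive for \<open>t \<ge> 0\<close>, and equal lengths with a common
  nonzero last coefficient give equal degrees.\<close>

lemma isogeny_check_step:
  assumes "isogeny_check p q m a b a' b' N D" "r\<^sup>2 = of_int p" "s\<^sup>2 = of_int q"
    and "m > 0" "qval r s b < 0" "qval r s b' < 0"
    and "D \<noteq> []" "list_all (\<lambda>x. qval r s x > 0) D" "length N = length D" "last N = last D"
    and "elliptic_integrable (qval r s a) (qval r s b)"
  shows "elliptic_integrable (qval r s a') (qval r s b') \<and>
    elliptic_integral (qval r s a') (qval r s b') =
    sqrt (of_int m) * elliptic_integral (qval r s a) (qval r s b)"
proof (rule elliptic_integral_isogeny[OF isogeny_check_sound[OF assms(1-3)]])
  have "qval r s (last D) > 0"
    using assms(7,8) by (simp add: list_all_iff)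
  then show "degree (lpoly r s N) = degree (lpoly r s D)"
    using lpoly_degree[of D r s] lpoly_degree[of N r s] assms(7,9,10) by fastforce
qed (use assms lpoly_pos in auto)

section \<open>Reduction of the Lauricella functions\<close>

text \<open>For \<open>x = -1\<close> and \<open>z = -y\<close> this is the integrand of
  \<open>G\<close> without its Gamma factor; \<open>u\<close> times it is that of
  \<open>H2\<close>.\<close>

definition elliptic_weight :: "real \<Rightarrow> real \<Rightarrow> real" where
  "elliptic_weight y u = 1 / sqrt (u * (1 - u\<^sup>2) * (1 - y\<^sup>2 * u\<^sup>2))"

lemma elliptic_weight_factors_pos:
  fixes u y :: real
  assumes "0 < y" "y < 1" "0 < u" "u < 1"
  shows "1 - u\<^sup>2 > 0" "1 - y\<^sup>2 * u\<^sup>2 > 0"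
proof -
  have "y * u < 1"
    using mult_strict_mono[of y 1 u 1] assms by simp
  then have "u\<^sup>2 < 1" "(y * u)\<^sup>2 < 1"
    using assms by (simp_all add: power_less_one_iff)
  then show "1 - u\<^sup>2 > 0" "1 - y\<^sup>2 * u\<^sup>2 > 0"
    by (simp_all add: power_mult_distrib)
qed

text \<open>Since \<open>u^2 \<le> u\<close> and \<open>y^2 u^2 \<le> y^2\<close>, the weight is at
  most \<open>1 / sqrt (1 - y^2)\<close> times the Beta integrand with both parameters 1/2.\<close>

lemma set_integrable_elliptic_weight:
  assumes "0 < y" "y < 1"
  shows "set_integrable lborel {0<..<1} (elliptic_weight y)"
proof (rule set_integrable_bound)
  have "set_integrable lborel {0<..<1::real} (\<lambda>t. t powr (1/2 - 1) * (1 - t) powr (1/2 - 1))"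
    by (rule set_integrable_subset[OF integrable_Beta]) auto
  then show "set_integrable lborel {0<..<1::real}
      (\<lambda>t. 1 / sqrt (1 - y\<^sup>2) * (t powr (1/2 - 1) * (1 - t) powr (1/2 - 1)))"
    by (rule set_integrable_mult_right)
  show "set_borel_measurable lborel {0<..<1} (elliptic_weight y)"
    unfolding set_borel_measurable_def elliptic_weight_def by measurable
  have "norm (elliptic_weight y u)
      \<le> norm (1 / sqrt (1 - y\<^sup>2) * (u powr (1/2 - 1) * (1 - u) powr (1/2 - 1)))" if u: "0 < u" "u < 1" for u
  proof -
    have y: "y\<^sup>2 < 1"
      using assms by (simp add: power_less_one_iff)
    have "u\<^sup>2 \<le> u" "y\<^sup>2 * u\<^sup>2 \<le> y\<^sup>2"
      using u by (auto simp: power2_eq_square mult_le_one intro: mult_left_le)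
    then have "u * (1 - u) * (1 - y\<^sup>2) \<le> u * (1 - u\<^sup>2) * (1 - y\<^sup>2 * u\<^sup>2)"
      using u y by (intro mult_mono) auto
    then have "elliptic_weight y u \<le> 1 / sqrt (u * (1 - u) * (1 - y\<^sup>2))"
      unfolding elliptic_weight_def using u y elliptic_weight_factors_pos[OF assms u]
      by (intro divide_left_mono mult_pos_pos) auto
    also have "\<dots> = 1 / sqrt (1 - y\<^sup>2) * (u powr (1/2 - 1) * (1 - u) powr (1/2 - 1))"
    proof -
      have "u powr (1/2 - 1) = 1 / sqrt u" "(1 - u) powr (1/2 - 1) = 1 / sqrt (1 - u)"
        using u by (simp_all add: powr_minus powr_half_sqrt divide_simps)
      then show ?thesis
        by (simp add: real_sqrt_mult)
    qed
    finally show ?thesis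
      using u elliptic_weight_factors_pos[OF assms u] less_imp_le[OF y]
      by (simp add: elliptic_weight_def)
  qed
  then show "AE u in lborel. u \<in> {0<..<1} \<longrightarrow> norm (elliptic_weight y u)
      \<le> norm (1 / sqrt (1 - y\<^sup>2) * (u powr (1/2 - 1) * (1 - u) powr (1/2 - 1)))"
    by auto
qed

lemma set_integrable_mult_elliptic_weight:
  assumes "0 < y" "y < 1"
  shows "set_integrable lborel {0<..<1} (\<lambda>u. u * elliptic_weight y u)"
proof (rule set_integrable_bound[OF set_integrable_elliptic_weight[OF assms]])
  show "set_borel_measurable lborel {0<..<1} (\<lambda>u. u * elliptic_weight y u)"
    unfolding set_borel_measurable_def elliptic_weight_def by measurable
qed (auto simp: abs_mult intro!: AE_I2 mult_left_le_one_le)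

section \<open>From the weights to elliptic integrals\<close>

definition weight_integral :: "real \<Rightarrow> real" where
  "weight_integral y = (LINT u:{0<..<1}|lborel. elliptic_weight y u)"

definition weight_moment :: "real \<Rightarrow> real" where
  "weight_moment y = (LINT u:{0<..<1}|lborel. u * elliptic_weight y u)"

text \<open>Everything factors: \<open>h u = k (1 - e r u)^2 / (r u)\<close>, and the two roots of
  the quadratic give \<open>h u - h 1 = k (1 - u) (1 - r^2 u) / (r u)\<close> and a second factor
  \<open>k (1 + u) (1 + r^2 u) / (r u)\<close>. In \<open>h'\<close> the numerator is
  \<open>(1 - e r u) (1 + e r u)\<close>, so \<open>1 - e r u\<close> cancels and
  \<open>1 + e r u\<close> survives.\<close>

lemma elliptic_substitution:
  fixes r k e :: real
  assumes r: "0 < r" "r < 1" and k: "k > 0" and e: "e = 1 \<or> e = -1"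
  defines "h \<equiv> \<lambda>u. k * (r * u + 1 / (r * u) - 2 * e)"
    and "h' \<equiv> \<lambda>u. - (k * (1 - r\<^sup>2 * u\<^sup>2) / (r * u\<^sup>2))"
    and "a \<equiv> 4 * e * k" and "b \<equiv> - (k\<^sup>2 * (r - 1 / r)\<^sup>2)"
  shows "\<And>u. 0 < u \<Longrightarrow> u < 1 \<Longrightarrow> (h has_field_derivative h' u) (at u)"
    and "\<And>u. 0 < u \<Longrightarrow> u < 1 \<Longrightarrow>
          \<bar>h' u\<bar> * elliptic_integrand a b (h u) = sqrt (r / k) * ((1 + e * r * u) * elliptic_weight (r\<^sup>2) u)"
    and "inj_on h {0<..<1}"
    and "h ` {0<..<1} = {cubic_root a b<..}"
proof -
  have e2: "e\<^sup>2 = 1" using e by auto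
  have ru: "r * u < 1" if "0 < u" "u \<le> 1" for u
    using mult_left_le[of u r] r that by linarith
  show deriv: "(h has_field_derivative h' u) (at u)" if "0 < u" "u < 1" for u
    unfolding h_def h'_def using that r
    by (auto intro!: derivative_eq_intros simp: field_simps power2_eq_square)
  show "\<bar>h' u\<bar> * elliptic_integrand a b (h u) = sqrt (r / k) * ((1 + e * r * u) * elliptic_weight (r\<^sup>2) u)"
    if u: "0 < u" "u < 1" for u
  proof -
    have er: "1 + e * r * u > 0" "1 - r * u > 0"
      using ru[of u] u r e by (auto intro: add_pos_pos)
    then have h'0: "h' u \<noteq> 0"
      using u r k power_less_one_iff[of "r * u" 2] by (simp add: h'_def power_mult_distrib)
    have "h u * ((h u)\<^sup>2 + a * h u + b) * (1 + e * r * u)\<^sup>2 * r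
        = (h' u)\<^sup>2 * k * (u * (1 - u\<^sup>2) * (1 - (r\<^sup>2)\<^sup>2 * u\<^sup>2))"
      using e2 u r unfolding h_def h'_def a_def b_def
      by (simp add: divide_simps) algebra
    then have "h u * ((h u)\<^sup>2 + a * h u + b)
        = (h' u)\<^sup>2 * (u * (1 - u\<^sup>2) * (1 - (r\<^sup>2)\<^sup>2 * u\<^sup>2)) / ((r / k) * (1 + e * r * u)\<^sup>2)"
      using er r k by (simp add: field_simps)
    then have "elliptic_integrand a b (h u) = sqrt (r / k) * ((1 + e * r * u) * elliptic_weight (r\<^sup>2) u) / \<bar>h' u\<bar>"
      unfolding elliptic_integrand_def elliptic_weight_def using er
      by (simp add: real_sqrt_divide real_sqrt_mult)
    then show ?thesis
      using h'0 by simp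
  qed
  show inj: "inj_on h {0<..<1}"
  proof (rule inj_onI)
    fix u v assume uv: "u \<in> {0<..<1}" "v \<in> {0<..<1}" "h u = h v"
    \<comment> \<open>The last factor of the numerator is negative because \<open>r * u\<close> and
      \<open>r * v\<close> are below 1.\<close>
    have "h u - h v = k * ((u - v) * (r * u * (r * v) - 1)) / (r * u * v)"
      unfolding h_def using uv(1,2) r by (simp add: divide_simps) algebra
    then have "(u - v) * (r * u * (r * v) - 1) = 0"
      using uv k r by simp
    moreover have "r * u * (r * v) < 1"
      using uv mult_strict_mono[of "r * u" 1 "r * v" 1] ru[of u] ru[of v] r by auto
    ultimately show "u = v" by auto
  qed
  have "sqrt (a\<^sup>2 - 4 * b) = 2 * k * (r + 1 / r)"
    using k r e2 unfolding a_def b_def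
    by (intro real_sqrt_unique) (auto simp: field_simps power2_eq_square)
  then have root: "cubic_root a b = h 1"
    by (simp add: cubic_root_def h_def a_def field_simps)
  have less: "h 1 < h u" if "0 < u" "u < 1" for u
  proof -
    have "h u - h 1 = k * (1 - u) * (1 - r * (r * u)) / (r * u)"
      unfolding h_def using that r by (simp add: field_simps)
    moreover have "r * (r * u) < 1"
      using mult_strict_mono[of r 1 "r * u" 1] ru[of u] that r by auto
    ultimately show ?thesis
      using that r k by (smt (verit) divide_pos_pos mult_pos_pos)
  qed
  have "v \<in> h ` {0<..<1}" if v: "v > h 1" for v
  proof -
    \<comment> \<open>Chosen so that \<open>k (1 / (r u) - 2) = k / r + \<bar>v\<bar>\<close>, which
      bounds \<open>v\<close> above and \<open>h u\<close> below.\<close>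
    define u where "u = 1 / (1 + r * (\<bar>v\<bar> / k + 2))"
    have "r * (\<bar>v\<bar> / k + 2) > 0"
      using r k by (intro mult_pos_pos add_nonneg_pos) auto
    then have u: "0 < u" "u < 1"
      by (simp_all add: u_def)
    have "k * (1 / (r * u) - 2) = k / r + \<bar>v\<bar>"
      unfolding u_def using r k by (simp add: field_simps)
    then have "v \<le> k * (1 / (r * u) - 2)"
      using divide_pos_pos[OF k r(1)] by linarith
    also have "\<dots> \<le> h u"
      unfolding h_def using u r k e by (intro mult_left_mono) auto
    finally have "v \<le> h u" .
    moreover have "continuous_on {u..1} h"
      unfolding h_def using u r by (auto intro!: continuous_intros)
    ultimately obtain w where "u \<le> w" "w \<le> 1" "h w = v"
      using IVT2'[of h 1 v u] v u by auto
    then show ?thesis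
      using v u by (intro image_eqI[of _ _ w]) (auto simp: less_le)
  qed
  then show "h ` {0<..<1} = {cubic_root a b<..}"
    using less root by auto
qed

text \<open>The two signs of \<open>e\<close> share \<open>b\<close> and differ in the sign of
  \<open>a\<close>, so both elliptic integrals are combinations of the same integral and
  moment.\<close>

lemma elliptic_integral_weight:
  fixes r k e :: real
  assumes r: "0 < r" "r < 1" and k: "k > 0" and e: "e = 1 \<or> e = -1"
  defines "a \<equiv> 4 * e * k" and "b \<equiv> - (k\<^sup>2 * (r - 1 / r)\<^sup>2)"
  shows "elliptic_integrable a b \<and>
    elliptic_integral a b = sqrt (r / k) * (weight_integral (r\<^sup>2) + e * r * weight_moment (r\<^sup>2))"
proof -
  define h where "h = (\<lambda>u. k * (r * u + 1 / (r * u) - 2 * e))"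
  define h' where "h' = (\<lambda>u. - (k * (1 - r\<^sup>2 * u\<^sup>2) / (r * u\<^sup>2)))"
  define f where "f = (\<lambda>u. sqrt (r / k) * ((1 + e * r * u) * elliptic_weight (r\<^sup>2) u))"
  have f_eq: "f = (\<lambda>u. sqrt (r / k) * (elliptic_weight (r\<^sup>2) u + e * r * (u * elliptic_weight (r\<^sup>2) u)))"
    by (simp add: f_def fun_eq_iff algebra_simps)
  note sub = elliptic_substitution[OF assms(1-4), folded h_def a_def b_def]
  have y: "0 < r\<^sup>2" "r\<^sup>2 < 1"
    using r by (auto simp: power_less_one_iff)
  note int = set_integrable_elliptic_weight[OF y] set_integrable_mult_elliptic_weight[OF y]
  have f: "set_integrable lborel {0<..<1} f"
    unfolding f_eq by (intro set_integrable_mult_right set_integral_add int)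
  have "(LINT u:{0<..<1}|lborel. f u) = sqrt (r / k) * (weight_integral (r\<^sup>2) + e * r * weight_moment (r\<^sup>2))"
    unfolding f_eq using int
    by (simp add: set_integral_add set_integrable_mult_right weight_integral_def weight_moment_def)
  then have fint: "integral {0<..<1} f = sqrt (r / k) * (weight_integral (r\<^sup>2) + e * r * weight_moment (r\<^sup>2))"
    using set_borel_integral_eq_integral(2)[OF f] by simp
  have fabs: "f absolutely_integrable_on {0<..<1}"
    using f unfolding set_integrable_def by (simp add: integrable_completion borel_measurable_integrable)
  have eq: "\<bar>h' u\<bar> * elliptic_integrand a b (h u) = f u" if "u \<in> {0<..<1}" for u
    unfolding h_def h'_def f_def using that by (intro sub(2)) auto
  have "(\<lambda>u. \<bar>h' u\<bar> * elliptic_integrand a b (h u)) absolutely_integrable_on {0<..<1}"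
    using fabs by (subst set_integrable_cong[OF refl refl eq]) auto
  moreover have "integral {0<..<1} (\<lambda>u. \<bar>h' u\<bar> * elliptic_integrand a b (h u)) = integral {0<..<1} f"
    by (rule integral_cong[OF eq])
  moreover have "{0<..<1::real} \<in> sets lebesgue" by simp
  moreover have "(h has_field_derivative h' u) (at u within {0<..<1})" if "u \<in> {0<..<1}" for u
    unfolding h'_def using sub(1)[of u] that by (auto intro: has_field_derivative_at_within)
  ultimately show ?thesis
    using has_absolute_integral_change_of_variables_1'[of "{0<..<1}" h h' "elliptic_integrand a b"
        "integral {0<..<1} f"] sub(3,4) fint
    by (simp add: elliptic_integral_def elliptic_integrable_def)
qed

section \<open>The Lauricella functions as weight integrals\<close>

lemma lauricella_integrand:
  fixes y u :: real
  assumes "0 < y" "y < 1" "0 < u" "u < 1"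
  shows "(1 - of_real (-1) * of_real u) powr of_real (1/2) *
      (1 - of_real y * of_real u) powr of_real (1/2) *
      (1 - of_real (-y) * of_real u) powr of_real (1/2)
    = complex_of_real (sqrt ((1 + u) * (1 - y\<^sup>2 * u\<^sup>2)))"
proof -
  have yu: "y * u < 1"
    using mult_strict_mono[of y 1 u 1] assms by simp
  \<comment> \<open>Each base is a nonnegative real, so the principal power is the real square
    root.\<close>
  have root: "(1 - of_real x * of_real u) powr of_real (1/2) = complex_of_real (sqrt (1 - x * u))"
    if "1 - x * u \<ge> 0" for x
  proof -
    have "1 - of_real x * of_real u = complex_of_real (1 - x * u)"
      by simp
    then show ?thesis
      using powr_of_real[OF that, of "1/2"] powr_half_sqrt[OF that] by metis
  qed
  have "sqrt (1 - (-1) * u) * sqrt (1 - y * u) * sqrt (1 - (-y) * u) = sqrt ((1 + u) * (1 - y\<^sup>2 * u\<^sup>2))"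
    unfolding real_sqrt_mult[symmetric]
    by (rule arg_cong[where f = sqrt]) (simp add: algebra_simps power2_eq_square)
  moreover have "1 - (-1) * u \<ge> 0" "1 - y * u \<ge> 0" "1 - (-y) * u \<ge> 0"
    using assms yu by auto
  ultimately show ?thesis
    using root[of "-1"] root[of y] root[of "-y"] by (metis of_real_mult)
qed

lemma elliptic_weight_factor:
  "elliptic_weight y u = 1 / (sqrt u * sqrt (1 - u) * sqrt ((1 + u) * (1 - y\<^sup>2 * u\<^sup>2)))"
proof -
  have "u * (1 - u\<^sup>2) * (1 - y\<^sup>2 * u\<^sup>2) = u * (1 - u) * ((1 + u) * (1 - y\<^sup>2 * u\<^sup>2))"
    by (simp add: algebra_simps power2_eq_square)
  then show ?thesis
    unfolding elliptic_weight_def by (simp only: real_sqrt_mult mult.assoc)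
qed

lemma G_eq_weight:
  assumes "0 < y" "y < 1"
  shows "G (of_real (-1)) (of_real y) (of_real (-y)) = of_real (weight_integral y / pi)"
proof -
  have "(LINT u:{0<..<1}|lborel. of_real (u powr (1/2 - 1) * (1 - u) powr (1 - 1/2 - 1)) /
      ((1 - of_real (-1) * of_real u) powr of_real (1/2) * (1 - of_real y * of_real u) powr of_real (1/2) *
       (1 - of_real (-y) * of_real u) powr of_real (1/2)))
    = (LINT u:{0<..<1}|lborel. complex_of_real (elliptic_weight y u))"
  proof (rule set_lebesgue_integral_cong)
    show "\<forall>u. u \<in> {0<..<1} \<longrightarrow> of_real (u powr (1/2 - 1) * (1 - u) powr (1 - 1/2 - 1)) /
      ((1 - of_real (-1) * of_real u) powr of_real (1/2) * (1 - of_real y * of_real u) powr of_real (1/2) *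
       (1 - of_real (-y) * of_real u) powr of_real (1/2)) = complex_of_real (elliptic_weight y u)"
    proof (intro allI impI)
      fix u :: real assume "u \<in> {0<..<1}"
      then have u: "0 < u" "u < 1" by auto
      have "u powr (1/2 - 1) = 1 / sqrt u" "(1 - u) powr (1 - 1/2 - 1) = 1 / sqrt (1 - u)"
        using u by (simp_all add: powr_minus powr_half_sqrt divide_simps)
      then have "u powr (1/2 - 1) * (1 - u) powr (1 - 1/2 - 1) / sqrt ((1 + u) * (1 - y\<^sup>2 * u\<^sup>2))
        = elliptic_weight y u"
        by (simp only: elliptic_weight_factor) simp
      then show "of_real (u powr (1/2 - 1) * (1 - u) powr (1 - 1/2 - 1)) /
      ((1 - of_real (-1) * of_real u) powr of_real (1/2) * (1 - of_real y * of_real u) powr of_real (1/2) *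
       (1 - of_real (-y) * of_real u) powr of_real (1/2)) = complex_of_real (elliptic_weight y u)"
        unfolding lauricella_integrand[OF assms u] of_real_divide[symmetric] by (simp only:)
    qed
  qed simp
  also have "\<dots> = of_real (weight_integral y)"
    by (simp add: weight_integral_def set_integral_complex_of_real)
  finally show ?thesis
    unfolding G_def lauricella_FD3_def by (simp add: Gamma_one_half_real)
qed

lemma H2_eq_weight:
  assumes "0 < y" "y < 1"
  shows "H2 (of_real (-1)) (of_real y) (of_real (-y)) = of_real (2 * weight_moment y / pi)"
proof -
  have "(LINT u:{0<..<1}|lborel. of_real (u powr (3/2 - 1) * (1 - u) powr (2 - 3/2 - 1)) /
      ((1 - of_real (-1) * of_real u) powr of_real (1/2) * (1 - of_real y * of_real u) powr of_real (1/2) *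
       (1 - of_real (-y) * of_real u) powr of_real (1/2)))
    = (LINT u:{0<..<1}|lborel. complex_of_real (u * elliptic_weight y u))"
  proof (rule set_lebesgue_integral_cong)
    show "\<forall>u. u \<in> {0<..<1} \<longrightarrow> of_real (u powr (3/2 - 1) * (1 - u) powr (2 - 3/2 - 1)) /
      ((1 - of_real (-1) * of_real u) powr of_real (1/2) * (1 - of_real y * of_real u) powr of_real (1/2) *
       (1 - of_real (-y) * of_real u) powr of_real (1/2)) = complex_of_real (u * elliptic_weight y u)"
    proof (intro allI impI)
      fix u :: real assume "u \<in> {0<..<1}"
      then have u: "0 < u" "u < 1" by auto
      have "u powr (3/2 - 1) = u / sqrt u" "(1 - u) powr (2 - 3/2 - 1) = 1 / sqrt (1 - u)"
        using u by (simp_all add: powr_minus powr_half_sqrt divide_simps)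
      then have "u powr (3/2 - 1) * (1 - u) powr (2 - 3/2 - 1) / sqrt ((1 + u) * (1 - y\<^sup>2 * u\<^sup>2))
        = u * elliptic_weight y u"
        by (simp only: elliptic_weight_factor) simp
      then show "of_real (u powr (3/2 - 1) * (1 - u) powr (2 - 3/2 - 1)) /
      ((1 - of_real (-1) * of_real u) powr of_real (1/2) * (1 - of_real y * of_real u) powr of_real (1/2) *
       (1 - of_real (-y) * of_real u) powr of_real (1/2)) = complex_of_real (u * elliptic_weight y u)"
        unfolding lauricella_integrand[OF assms u] of_real_divide[symmetric] by (simp only:)
    qed
  qed simp
  also have "\<dots> = of_real (weight_moment y)"
    unfolding weight_moment_def by (rule set_integral_complex_of_real)
  finally have "H2 (of_real (-1)) (of_real y) (of_real (-y))
      = of_real (Gamma 2 / (Gamma (3/2) * Gamma (2 - 3/2))) * of_real (weight_moment y)"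
    unfolding H2_def lauricella_FD3_def by (simp only:)
  \<comment> \<open>The prefactor \<open>Gamma 2 / (Gamma (3/2) * Gamma (1/2))\<close> is
    \<open>2 / pi\<close>, twice that of \<open>G\<close>.\<close>
  moreover have "Gamma (3/2 :: real) = sqrt pi / 2"
    using Gamma_plus1[of "1/2 :: real"] nonpos_Ints_nonpos[of "1/2 :: real"]
    by (auto simp: Gamma_one_half_real)
  moreover have "Gamma (2 :: real) = 1"
    using Gamma_fact[of 1, where 'a = real] by simp
  ultimately show ?thesis
    by (simp add: Gamma_one_half_real)
qed

text \<open>With \<open>r = sqrt y\<close>, the curves \<open>a = 4 k\<close> and
  \<open>a = - 4 k\<close> give \<open>A + r B\<close> and \<open>A - r B\<close> up to a common
  factor, and \<open>iso\<close> makes their ratio \<open>sqrt n\<close>. Solving for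
  \<open>2 B / A\<close> yields \<open>R\<close>. The parameter \<open>y'\<close> is the inverse of
  \<open>y\<close> in rationalised form, and \<open>k\<close> is the rescaling of
  \<open>t\<close>.\<close>

lemma H2_eq_G:
  fixes y y' k n R :: real
  assumes y: "0 < y" "y < 1" and k: "k > 0" and n: "n > 0"
    and y': "y * y' = 1" and b: "b = - (k\<^sup>2 * (y + y' - 2))"
    and iso: "elliptic_integrable (- 4 * k) b \<Longrightarrow>
      elliptic_integral (4 * k) b = sqrt n * elliptic_integral (- 4 * k) b"
    and R: "R * sqrt y * (sqrt n + 1) = 2 * (sqrt n - 1)"
  shows "H2 (of_real (-1)) (of_real y) (of_real (-y)) =
    of_real R * G (of_real (-1)) (of_real y) (of_real (-y))"
proof -
  define r where "r = sqrt y"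
  define A where "A = weight_integral y"
  define B where "B = weight_moment y"
  have r: "0 < r" "r < 1" and r2: "r\<^sup>2 = y"
    using y by (auto simp: r_def)
  have b': "b = - (k\<^sup>2 * (r - 1 / r)\<^sup>2)"
  proof -
    have "y' = 1 / r\<^sup>2"
      using y y' by (simp add: r2 field_simps)
    then show ?thesis
      using r by (simp add: b r2[symmetric] field_simps power2_eq_square)
  qed
  have "elliptic_integral (4 * k) b = sqrt (r / k) * (A + r * B)"
    "elliptic_integral (- 4 * k) b = sqrt (r / k) * (A - r * B)" "elliptic_integrable (- 4 * k) b"
    using elliptic_integral_weight[OF r k, of 1] elliptic_integral_weight[OF r k, of "-1"]
    by (simp_all add: b' r2 A_def B_def)
  then have "sqrt (r / k) * (A + r * B) = sqrt (r / k) * (sqrt n * (A - r * B))"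
    using iso by simp
  then have "A + r * B = sqrt n * (A - r * B)"
    using r k by simp
  then have "2 * B * (r * (sqrt n + 1)) = A * (2 * (sqrt n - 1))"
    by (simp add: algebra_simps)
  also have "\<dots> = R * A * (r * (sqrt n + 1))"
    unfolding R[symmetric] r_def by simp
  finally have "2 * B = R * A"
    using r n by (simp add: add_pos_pos less_imp_neq[symmetric])
  then show ?thesis
    unfolding H2_eq_weight[OF y] G_eq_weight[OF y] A_def[symmetric] B_def[symmetric]
    by (simp flip: of_real_mult)
qed

section \<open>The isogenies\<close>

text \<open>
  The variable $t$ is rescaled by an integer $k$ to make the curve coefficients integral. The
  roots of $D$ are the $t$-coordinates of the kernel points of the isogeny, and $N$ is
  proportional to $t^{\deg D} D(b/t)$, because translation by the 2-torsion point $(0,0)$ is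
  $t \mapsto b/t$. The coefficients were computed numerically and then recognised.
\<close>

lemma sqrt_bounds:
  fixes l x u :: real
  assumes "l * l < x" "x < u * u" "0 < u"
  shows "l < sqrt x" "sqrt x < u"
  using assms by (auto intro: real_less_rsqrt real_less_lsqrt less_imp_le simp: power2_eq_square)

text \<open>Many decimals are kept because coefficients of \<open>D\<close> nearly cancel:
  \<open>84305 - 23382 * sqrt 13\<close>, from order 13, is positive but below
  \<open>10^(-4)\<close>.\<close>

lemma sqrt_3_bounds: "1.732050807568 < sqrt 3" "sqrt 3 < 1.732050807569"
  using sqrt_bounds[of "1.732050807568" 3 "1.732050807569"] by simp_all

lemma sqrt_5_bounds: "2.236067977499 < sqrt 5" "sqrt 5 < 2.236067977500"
  using sqrt_bounds[of "2.236067977499" 5 "2.236067977500"] by simp_all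

lemma sqrt_11_bounds: "3.316624790355 < sqrt 11" "sqrt 11 < 3.316624790356"
  using sqrt_bounds[of "3.316624790355" 11 "3.316624790356"] by simp_all

lemma sqrt_13_bounds: "3.605551275463 < sqrt 13" "sqrt 13 < 3.605551275464"
  using sqrt_bounds[of "3.605551275463" 13 "3.605551275464"] by simp_all

lemma sqrt_33_bounds: "5.744562646538 < sqrt 33" "sqrt 33 < 5.744562646539"
  using sqrt_bounds[of "5.744562646538" 33 "5.744562646539"] by simp_all

text \<open>Over the complex numbers \<open>t \<mapsto> -t\<close>, \<open>w \<mapsto> i w\<close>
  identifies the curves with opposite \<open>a\<close>, which turns the isogeny into multiplication
  by a square root of -3. The coefficients are rational, hence the dummy roots
  \<open>r = s = 1\<close>. The other orders follow this pattern.\<close>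

lemma isogeny_order3:
  assumes "elliptic_integrable (- 12) (- 12)"
  shows "elliptic_integrable 12 (- 12) \<and>
    elliptic_integral 12 (- 12) =
    sqrt 3 * elliptic_integral (- 12) (- 12)"
proof -
  have "isogeny_check 1 1 3 (-12, 0, 0, 0) (-12, 0, 0, 0) (12, 0, 0, 0) (-12, 0, 0, 0)
    [(-6, 0, 0, 0), (1, 0, 0, 0)]
    [(2, 0, 0, 0), (1, 0, 0, 0)]"
    by code_simp
  from isogeny_check_step[OF this, of "1" "1"] show ?thesis
    using assms by simp
qed

lemma isogeny_order5:
  assumes "elliptic_integrable (- 4) (2 - sqrt 5)"
  shows "elliptic_integrable 4 (2 - sqrt 5) \<and>
    elliptic_integral 4 (2 - sqrt 5) =
    sqrt 5 * elliptic_integral (- 4) (2 - sqrt 5)"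
proof -
  have "isogeny_check 5 1 5 (-4, 0, 0, 0) (2, -1, 0, 0) (4, 0, 0, 0) (2, -1, 0, 0)
    [(25, -10, 0, 0), (-25, 5, 0, 0), (5, 0, 0, 0)]
    [(5, -2, 0, 0), (-5, 5, 0, 0), (5, 0, 0, 0)]"
    by code_simp
  from isogeny_check_step[OF this, of "sqrt 5" "1"] show ?thesis
    using assms sqrt_5_bounds by simp
qed

lemma isogeny_order7:
  assumes "elliptic_integrable (- 84) (- 28)"
  shows "elliptic_integrable 84 (- 28) \<and>
    elliptic_integral 84 (- 28) =
    sqrt 7 * elliptic_integral (- 84) (- 28)"
proof -
  have "isogeny_check 1 1 7 (-84, 0, 0, 0) (-28, 0, 0, 0) (84, 0, 0, 0) (-28, 0, 0, 0)
    [(-392, 0, 0, 0), (588, 0, 0, 0), (-70, 0, 0, 0), (1, 0, 0, 0)]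
    [(56, 0, 0, 0), (140, 0, 0, 0), (42, 0, 0, 0), (1, 0, 0, 0)]"
    by code_simp
  from isogeny_check_step[OF this, of "1" "1"] show ?thesis
    using assms by simp
qed

text \<open>Multiplication by \<open>3 i\<close> is split through a curve with \<open>a = 0\<close>,
  that is with \<open>j = 1728\<close> and complex multiplication by \<open>i\<close>. Order 25 does
  the same with \<open>5 i\<close>.\<close>

lemma isogeny_order9_first:
  assumes "elliptic_integrable (- 24) (72 - 42 * sqrt 3)"
  shows "elliptic_integrable 0 (- 18 * sqrt 3) \<and>
    elliptic_integral 0 (- 18 * sqrt 3) =
    sqrt 3 * elliptic_integral (- 24) (72 - 42 * sqrt 3)"
proof -
  have "isogeny_check 3 1 3 (-24, 0, 0, 0) (72, -42, 0, 0) (0, 0, 0, 0) (0, -18, 0, 0)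
    [(-9, 3, 0, 0), (1, 0, 0, 0)]
    [(-5, 3, 0, 0), (1, 0, 0, 0)]"
    by code_simp
  from isogeny_check_step[OF this, of "sqrt 3" "1"] show ?thesis
    using assms sqrt_3_bounds by simp
qed

lemma isogeny_order9_second:
  assumes "elliptic_integrable 0 (- 18 * sqrt 3)"
  shows "elliptic_integrable 24 (72 - 42 * sqrt 3) \<and>
    elliptic_integral 24 (72 - 42 * sqrt 3) =
    sqrt 3 * elliptic_integral 0 (- 18 * sqrt 3)"
proof -
  have "isogeny_check 3 1 3 (0, 0, 0, 0) (0, -18, 0, 0) (24, 0, 0, 0) (72, -42, 0, 0)
    [(-9, 3, 0, 0), (1, 0, 0, 0)]
    [(3, 3, 0, 0), (1, 0, 0, 0)]"
    by code_simp
  from isogeny_check_step[OF this, of "sqrt 3" "1"] show ?thesis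
    using assms sqrt_3_bounds by simp
qed

lemma isogeny_order13:
  assumes "elliptic_integrable (- 12) (18 - 5 * sqrt 13)"
  shows "elliptic_integrable 12 (18 - 5 * sqrt 13) \<and>
    elliptic_integral 12 (18 - 5 * sqrt 13) =
    sqrt 13 * elliptic_integral (- 12) (18 - 5 * sqrt 13)"
proof -
  have "isogeny_check 13 1 13 (-12, 0, 0, 0) (18, -5, 0, 0) (12, 0, 0, 0) (18, -5, 0, 0)
    [(1095965, -303966, 0, 0), (-1102387, 305747, 0, 0), (434161, -120406, 0, 0),
      (-85514, 23634, 0, 0), (8957, -2340, 0, 0), (-507, 91, 0, 0), (13, 0, 0, 0)]
    [(84305, -23382, 0, 0), (-150319, 41691, 0, 0), (86905, -24102, 0, 0), (-23634, 6578,
      0, 0), (3497, -884, 0, 0), (-143, 91, 0, 0), (13, 0, 0, 0)]"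
    by code_simp
  from isogeny_check_step[OF this, of "sqrt 13" "1"] show ?thesis
    using assms sqrt_13_bounds by simp
qed

text \<open>The degree 15 map is split into degrees 3 and 5 through a curve defined over the field
  of \<open>sqrt 5\<close>.\<close>

lemma isogeny_order15_first:
  assumes "elliptic_integrable (- 132) (- 6012 + 2688 * sqrt 5)"
  shows "elliptic_integrable (- 348 + 144 * sqrt 5) (- 252 - 96 * sqrt 5) \<and>
    elliptic_integral (- 348 + 144 * sqrt 5) (- 252 - 96 * sqrt 5) =
    sqrt 3 * elliptic_integral (- 132) (- 6012 + 2688 * sqrt 5)"
proof -
  have "isogeny_check 5 1 3 (-132, 0, 0, 0) (-6012, 2688, 0, 0) (-348, 144, 0, 0) (-252, -96, 0, 0)
    [(18, -12, 0, 0), (1, 0, 0, 0)]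
    [(-134, 60, 0, 0), (1, 0, 0, 0)]"
    by code_simp
  from isogeny_check_step[OF this, of "sqrt 5" "1"] show ?thesis
    using assms sqrt_5_bounds by simp
qed

lemma isogeny_order15_second:
  assumes "elliptic_integrable (- 348 + 144 * sqrt 5) (- 252 - 96 * sqrt 5)"
  shows "elliptic_integrable 132 (- 6012 + 2688 * sqrt 5) \<and>
    elliptic_integral 132 (- 6012 + 2688 * sqrt 5) =
    sqrt 5 * elliptic_integral (- 348 + 144 * sqrt 5) (- 252 - 96 * sqrt 5)"
proof -
  have "isogeny_check 5 1 5 (-348, 144, 0, 0) (-252, -96, 0, 0) (132, 0, 0, 0) (-6012, 2688, 0, 0)
    [(1500, -120, 0, 0), (-600, 180, 0, 0), (5, 0, 0, 0)]
    [(2220, 984, 0, 0), (240, 60, 0, 0), (5, 0, 0, 0)]"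
    by code_simp
  from isogeny_check_step[OF this, of "sqrt 5" "1"] show ?thesis
    using assms sqrt_5_bounds by simp
qed

lemma isogeny_order25_first:
  assumes "elliptic_integrable (- 120) (1800 - 805 * sqrt 5)"
  shows "elliptic_integrable 0 (- 125 * sqrt 5) \<and>
    elliptic_integral 0 (- 125 * sqrt 5) =
    sqrt 5 * elliptic_integral (- 120) (1800 - 805 * sqrt 5)"
proof -
  have "isogeny_check 5 1 5 (-120, 0, 0, 0) (1800, -805, 0, 0) (0, 0, 0, 0) (0, -125, 0, 0)
    [(2125, -950, 0, 0), (-75, 25, 0, 0), (1, 0, 0, 0)]
    [(1525, -682, 0, 0), (-55, 25, 0, 0), (1, 0, 0, 0)]"
    by code_simp
  from isogeny_check_step[OF this, of "sqrt 5" "1"] show ?thesis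
    using assms sqrt_5_bounds by simp
qed

lemma isogeny_order25_second:
  assumes "elliptic_integrable 0 (- 125 * sqrt 5)"
  shows "elliptic_integrable 120 (1800 - 805 * sqrt 5) \<and>
    elliptic_integral 120 (1800 - 805 * sqrt 5) =
    sqrt 5 * elliptic_integral 0 (- 125 * sqrt 5)"
proof -
  have "isogeny_check 5 1 5 (0, 0, 0, 0) (0, -125, 0, 0) (120, 0, 0, 0) (1800, -805, 0, 0)
    [(625, -250, 0, 0), (-75, 25, 0, 0), (1, 0, 0, 0)]
    [(625, 250, 0, 0), (25, 25, 0, 0), (1, 0, 0, 0)]"
    by code_simp
  from isogeny_check_step[OF this, of "sqrt 5" "1"] show ?thesis
    using assms sqrt_5_bounds by simp
qed

text \<open>Turns the bounds for \<open>sqrt 33\<close> into bounds for the product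
  \<open>sqrt 3 * sqrt 11\<close> that occurs in \<open>qval\<close>.\<close>

lemma sqrt_33: "sqrt 33 = sqrt 3 * sqrt (11 :: real)"
  by (simp flip: real_sqrt_mult)

lemma isogeny_order33_first:
  assumes "elliptic_integrable (- 48) (288 - 195 * sqrt 3 + 15 * sqrt 11)"
  shows "elliptic_integrable (- 84 + 12 * (sqrt 3 * sqrt 11)) (1476 - 855 * sqrt 3 + 435 * sqrt 11 - 252 * (sqrt 3 * sqrt 11)) \<and>
    elliptic_integral (- 84 + 12 * (sqrt 3 * sqrt 11)) (1476 - 855 * sqrt 3 + 435 * sqrt 11 - 252 * (sqrt 3 * sqrt 11)) =
    sqrt 3 * elliptic_integral (- 48) (288 - 195 * sqrt 3 + 15 * sqrt 11)"
proof -
  have "isogeny_check 3 11 3 (-48, 0, 0, 0) (288, -195, 15, 0) (-84, 0, 0, 12) (1476, -855, 435, -252)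
    [(27, -15, 15, -9), (2, 0, 0, 0)]
    [(-41, -15, 15, 3), (2, 0, 0, 0)]"
    by code_simp
  from isogeny_check_step[OF this, of "sqrt 3" "sqrt 11"] show ?thesis
    using assms sqrt_3_bounds sqrt_11_bounds sqrt_33_bounds[unfolded sqrt_33] by simp
qed

lemma isogeny_order33_second:
  assumes "elliptic_integrable (- 84 + 12 * (sqrt 3 * sqrt 11)) (1476 - 855 * sqrt 3 + 435 * sqrt 11 - 252 * (sqrt 3 * sqrt 11))"
  shows "elliptic_integrable 48 (288 - 195 * sqrt 3 + 15 * sqrt 11) \<and>
    elliptic_integral 48 (288 - 195 * sqrt 3 + 15 * sqrt 11) =
    sqrt 11 * elliptic_integral (- 84 + 12 * (sqrt 3 * sqrt 11)) (1476 - 855 * sqrt 3 + 435 * sqrt 11 - 252 * (sqrt 3 * sqrt 11))"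
proof -
  have "isogeny_check 3 11 11 (-84, 0, 0, 12) (1476, -855, 435, -252) (48, 0, 0, 0) (288, -195, 15, 0)
    [(-27805240980, 16053362820, -8382914100, 4839877548), (1671453828, -965010816,
      503395200, -290634300), (-39696228, 22914012, -11826540, 6826908), (482064, -274428,
      130284, -75504), (-3993, 1573, -429, 363), (22, 0, 0, 0)]
    [(-7436729124, 4293604260, -2242237140, 1294558236), (591238692, -341332992,
      178219008, -102889116), (-18044532, 10434204, -5420844, 3134604), (276144, -154572,
      80124, -44880), (-1749, 1573, -429, 319), (22, 0, 0, 0)]"
    by code_simp
  from isogeny_check_step[OF this, of "sqrt 3" "sqrt 11"] show ?thesis
    using assms sqrt_3_bounds sqrt_11_bounds sqrt_33_bounds[unfolded sqrt_33] by simp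
qed

section \<open>The eight cases\<close>

text \<open>Squaring removes \<open>sqrt y\<close> and the nested radicals of \<open>R\<close>;
  positivity of both sides undoes it.\<close>

lemma ratio_from_square:
  fixes R y n :: real
  assumes "R > 0" "y > 0" "n > 1" "R\<^sup>2 * y * (sqrt n + 1)\<^sup>2 = 4 * (sqrt n - 1)\<^sup>2"
  shows "R * sqrt y * (sqrt n + 1) = 2 * (sqrt n - 1)"
proof (rule power2_eq_imp_eq)
  show "(R * sqrt y * (sqrt n + 1))\<^sup>2 = (2 * (sqrt n - 1))\<^sup>2"
    using assms by (simp add: power_mult_distrib del: right_diff_distrib_numeral)
qed (use assms in auto)

lemma H2_eq_G_order3:
  assumes "y = 1/3" "R = 2 * sqrt 3 * (2 - sqrt 3)"
  shows "H2 (of_real (-1)) (of_real y) (of_real (-y)) =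
    of_real R * G (of_real (-1)) (of_real y) (of_real (-y))"
proof (rule H2_eq_G[where k = 3 and n = 3 and b = "- 12" and y' = 3])
  have eq: "R * (sqrt 3 + 1) = 2 * sqrt 3 * (sqrt 3 - 1)"
    by (simp add: assms(2) algebra_simps)
  have "R\<^sup>2 * y * (sqrt 3 + 1)\<^sup>2 = (R * (sqrt 3 + 1))\<^sup>2 * y"
    by (simp add: power_mult_distrib)
  also have "\<dots> = 4 * (sqrt 3 - 1)\<^sup>2"
    unfolding eq power_mult_distrib by (simp add: assms(1))
  finally have "R\<^sup>2 * y * (sqrt 3 + 1)\<^sup>2 = 4 * (sqrt 3 - 1)\<^sup>2" .
  then show "R * sqrt y * (sqrt 3 + 1) = 2 * (sqrt 3 - 1)"
    using sqrt_3_bounds by (intro ratio_from_square) (simp_all add: assms)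
qed (use assms isogeny_order3 in auto)

lemma H2_eq_G_order5:
  assumes "y = (sqrt 5 - 1) / 2" "R = 2 * sqrt (sqrt 5 - 2)"
  shows "H2 (of_real (-1)) (of_real y) (of_real (-y)) =
    of_real R * G (of_real (-1)) (of_real y) (of_real (-y))"
proof (rule H2_eq_G[where k = 1 and n = 5 and b = "2 - sqrt 5" and y' = "(sqrt 5 + 1) / 2"])
  have bounds: "2 < sqrt 5" "sqrt 5 < 3"
    using sqrt_bounds[of 2 5 3] by simp_all
  show "0 < y" "y < 1" "y * ((sqrt 5 + 1) / 2) = 1"
    "2 - sqrt 5 = - (1\<^sup>2 * (y + (sqrt 5 + 1) / 2 - 2))"
    using bounds by (simp_all add: assms field_simps)
  have "R\<^sup>2 = 4 * (sqrt 5 - 2)" "(sqrt 5)\<^sup>2 = (5 :: real)"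
    using bounds by (simp_all add: assms power_mult_distrib)
  then have "R\<^sup>2 * y * (sqrt 5 + 1)\<^sup>2 = 4 * (sqrt 5 - 1)\<^sup>2"
    unfolding assms(1) by algebra
  then show "R * sqrt y * (sqrt 5 + 1) = 2 * (sqrt 5 - 1)"
    using bounds by (intro ratio_from_square) (simp_all add: assms)
qed (use isogeny_order5 in auto)

lemma H2_eq_G_order7:
  assumes "y = 7/9" "R = 2 * (4 - sqrt 7) / sqrt 7"
  shows "H2 (of_real (-1)) (of_real y) (of_real (-y)) =
    of_real R * G (of_real (-1)) (of_real y) (of_real (-y))"
proof (rule H2_eq_G[where k = 21 and n = 7 and b = "- 28" and y' = "9/7"])
  have bounds: "2 < sqrt 7" "sqrt 7 < 3"
    using sqrt_bounds[of 2 7 3] by simp_all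
  have "R * sqrt 7 = 2 * (4 - sqrt 7)" "(sqrt 7)\<^sup>2 = (7 :: real)"
    by (simp_all add: assms)
  then have "R\<^sup>2 * y * (sqrt 7 + 1)\<^sup>2 = 4 * (sqrt 7 - 1)\<^sup>2"
    unfolding assms(1) by algebra
  then show "R * sqrt y * (sqrt 7 + 1) = 2 * (sqrt 7 - 1)"
    using bounds by (intro ratio_from_square) (simp_all add: assms)
qed (use assms isogeny_order7 in auto)

lemma H2_eq_G_order9:
  assumes "y = sqrt 3 / 2" "R = sqrt 2 / root 4 3"
  shows "H2 (of_real (-1)) (of_real y) (of_real (-y)) =
    of_real R * G (of_real (-1)) (of_real y) (of_real (-y))"
proof (rule H2_eq_G[where k = 6 and n = 9 and b = "72 - 42 * sqrt 3" and y' = "2 * sqrt 3 / 3"])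
  have bounds: "1 < sqrt 3" "sqrt 3 < 2"
    using sqrt_bounds[of 1 3 2] by simp_all
  show "0 < y" "y < 1" "y * (2 * sqrt 3 / 3) = 1"
    "72 - 42 * sqrt 3 = - (6\<^sup>2 * (y + 2 * sqrt 3 / 3 - 2))"
    using bounds by (simp_all add: assms field_simps)
  have "(root 4 3)\<^sup>2 = sqrt 3"
    using real_root_mult_exp[of 2 2 3] by (simp add: sqrt_def)
  then have "R\<^sup>2 * sqrt 3 = 2" "(sqrt 3)\<^sup>2 = (3 :: real)"
    by (simp_all add: assms power_divide)
  \<comment> \<open>Here \<open>R^2 y = 1\<close>, and both sides equal 16.\<close>
  then have "R\<^sup>2 * y * (sqrt 9 + 1)\<^sup>2 = 4 * (sqrt 9 - 1)\<^sup>2"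
    by (simp add: assms(1))
  then show "R * sqrt y * (sqrt 9 + 1) = 2 * (sqrt 9 - 1)"
    by (intro ratio_from_square) (simp_all add: assms)
qed (use isogeny_order9_first isogeny_order9_second in auto)

lemma H2_eq_G_order13:
  assumes "y = (5 * sqrt 13 - 1) / 18" "R = 2 * sqrt (37 * sqrt 13 - 106) / 9"
  shows "H2 (of_real (-1)) (of_real y) (of_real (-y)) =
    of_real R * G (of_real (-1)) (of_real y) (of_real (-y))"
proof (rule H2_eq_G[where k = 3 and n = 13 and b = "18 - 5 * sqrt 13" and y' = "(5 * sqrt 13 + 1) / 18"])
  have bounds: "36 / 10 < sqrt 13" "sqrt 13 < 37 / 10"
    using sqrt_bounds[of "36 / 10" 13 "37 / 10"] by simp_all
  show "0 < y" "y < 1" "y * ((5 * sqrt 13 + 1) / 18) = 1"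
    "18 - 5 * sqrt 13 = - (3\<^sup>2 * (y + (5 * sqrt 13 + 1) / 18 - 2))"
    using bounds by (simp_all add: assms field_simps)
  have "R\<^sup>2 * 81 = 4 * (37 * sqrt 13 - 106)" "(sqrt 13)\<^sup>2 = (13 :: real)"
    using bounds by (simp_all add: assms power_mult_distrib power_divide)
  then have "R\<^sup>2 * y * (sqrt 13 + 1)\<^sup>2 = 4 * (sqrt 13 - 1)\<^sup>2"
    unfolding assms(1) by algebra
  then show "R * sqrt y * (sqrt 13 + 1) = 2 * (sqrt 13 - 1)"
    using bounds by (intro ratio_from_square) (simp_all add: assms)
qed (use isogeny_order13 in auto)

lemma H2_eq_G_order15:
  assumes "y = 3/121 * (21 + 8 * sqrt 5)"
    and "R = 2 * (sqrt 3 - 3 * sqrt 5) * (sqrt 5 - 4) / (3 * (1 + sqrt 15))"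
  shows "H2 (of_real (-1)) (of_real y) (of_real (-y)) =
    of_real R * G (of_real (-1)) (of_real y) (of_real (-y))"
proof (rule H2_eq_G[where k = 33 and n = 15 and b = "- 6012 + 2688 * sqrt 5"
      and y' = "(21 - 8 * sqrt 5) / 3"])
  have bounds: "2 < sqrt 5" "sqrt 5 < 9 / 4" "sqrt 3 < 2" "3 < sqrt 15"
    using sqrt_bounds[of 2 5 "9 / 4"] sqrt_bounds[of 1 3 2] sqrt_bounds[of 3 15 4]
    by simp_all
  show y: "0 < y" "y < 1" "y * ((21 - 8 * sqrt 5) / 3) = 1"
    "- 6012 + 2688 * sqrt 5 = - (33\<^sup>2 * (y + (21 - 8 * sqrt 5) / 3 - 2))"
    using bounds by (simp_all add: assms field_simps)
  have "sqrt 15 = sqrt 3 * sqrt (5 :: real)" "(sqrt 3)\<^sup>2 = (3 :: real)" "(sqrt 5)\<^sup>2 = (5 :: real)"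
    by (simp_all flip: real_sqrt_mult)
  moreover have "R * (3 * (1 + sqrt 15)) = 2 * (sqrt 3 - 3 * sqrt 5) * (sqrt 5 - 4)"
    using bounds by (simp add: assms)
  ultimately have "R\<^sup>2 * y * (sqrt 15 + 1)\<^sup>2 = 4 * (sqrt 15 - 1)\<^sup>2"
    unfolding assms(1) by algebra
  \<comment> \<open>Both \<open>sqrt 3 - 3 * sqrt 5\<close> and \<open>sqrt 5 - 4\<close> are
    negative.\<close>
  moreover have "R > 0"
    unfolding assms using bounds by (intro divide_pos_pos[OF mult_neg_neg]) auto
  ultimately show "R * sqrt y * (sqrt 15 + 1) = 2 * (sqrt 15 - 1)"
    using y by (intro ratio_from_square) simp_all
  show "elliptic_integral (4 * 33) (- 6012 + 2688 * sqrt 5) =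
      sqrt 15 * elliptic_integral (- 4 * 33) (- 6012 + 2688 * sqrt 5)"
    if "elliptic_integrable (- 4 * 33) (- 6012 + 2688 * sqrt 5)"
    using isogeny_order15_first isogeny_order15_second that \<open>sqrt 15 = sqrt 3 * sqrt 5\<close> by simp
qed auto

lemma H2_eq_G_order25:
  assumes "y = 4 * sqrt 5 / 9" "R = 2 / root 4 5"
  shows "H2 (of_real (-1)) (of_real y) (of_real (-y)) =
    of_real R * G (of_real (-1)) (of_real y) (of_real (-y))"
proof (rule H2_eq_G[where k = 30 and n = 25 and b = "1800 - 805 * sqrt 5" and y' = "9 * sqrt 5 / 20"])
  have bounds: "2 < sqrt 5" "sqrt 5 < 9 / 4"
    using sqrt_bounds[of 2 5 "9 / 4"] by simp_all
  show "0 < y" "y < 1" "y * (9 * sqrt 5 / 20) = 1"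
    "1800 - 805 * sqrt 5 = - (30\<^sup>2 * (y + 9 * sqrt 5 / 20 - 2))"
    using bounds by (simp_all add: assms field_simps)
  have "(root 4 5)\<^sup>2 = sqrt 5"
    using real_root_mult_exp[of 2 2 5] by (simp add: sqrt_def)
  then have "R\<^sup>2 * sqrt 5 = 4"
    by (simp_all add: assms power_divide)
  \<comment> \<open>Here \<open>R^2 y = 16/9\<close>, and both sides equal 64.\<close>
  then have "R\<^sup>2 * y * (sqrt 25 + 1)\<^sup>2 = 4 * (sqrt 25 - 1)\<^sup>2"
    by (simp add: assms(1))
  then show "R * sqrt y * (sqrt 25 + 1) = 2 * (sqrt 25 - 1)"
    by (intro ratio_from_square) (simp_all add: assms)
qed (use isogeny_order25_first isogeny_order25_second in auto)

lemma H2_eq_G_order33: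
  assumes "y = 16 / (15 * sqrt 3 - 3 * sqrt 11)"
    and "R = sqrt 3 * (17 - sqrt 33) * root 4 (43 - 5 * sqrt 33) / 2 powr (19/4)"
  shows "H2 (of_real (-1)) (of_real y) (of_real (-y)) =
    of_real R * G (of_real (-1)) (of_real y) (of_real (-y))"
proof (rule H2_eq_G[where k = 12 and n = 33 and b = "288 - 195 * sqrt 3 + 15 * sqrt 11"
      and y' = "(15 * sqrt 3 - 3 * sqrt 11) / 16"])
  have bounds: "1732 / 1000 < sqrt 3" "sqrt 3 < 17321 / 10000" "33166 / 10000 < sqrt 11"
    "sqrt 11 < 33167 / 10000" "5 < sqrt 33" "sqrt 33 < 6"
    using sqrt_bounds[of "1732 / 1000" 3 "17321 / 10000"] sqrt_bounds[of "33166 / 10000" 11 "33167 / 10000"]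
      sqrt_bounds[of 5 33 6]
    by simp_all
  have roots: "sqrt 33 = sqrt 3 * sqrt 11" "(sqrt 3)\<^sup>2 = (3 :: real)" "(sqrt 11)\<^sup>2 = (11 :: real)"
    by (simp_all add: sqrt_33)
  show y': "y * ((15 * sqrt 3 - 3 * sqrt 11) / 16) = 1"
    using bounds by (simp add: assms)
  \<comment> \<open>Rationalises the denominator of \<open>y\<close>: both numbers are inverse to
    the same \<open>y'\<close>.\<close>
  have "(5 * sqrt 3 + sqrt 11) / 12 * ((15 * sqrt 3 - 3 * sqrt 11) / 16) = 1"
    using roots by algebra
  with y' have y_eq: "y = (5 * sqrt 3 + sqrt 11) / 12"
    by (metis mult_right_cancel zero_neq_one mult_zero_right)
  show y: "0 < y" "y < 1"
    "288 - 195 * sqrt 3 + 15 * sqrt 11 = - (12\<^sup>2 * (y + (15 * sqrt 3 - 3 * sqrt 11) / 16 - 2))"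
    using bounds by (simp_all add: y_eq field_simps)
  have R: "R > 0"
    unfolding assms using bounds by simp
  have "(2 powr (19/4)) ^ 4 = (2 ^ 19 :: real)"
    by (simp add: powr_power)
  moreover have "root 4 (43 - 5 * sqrt 33) ^ 4 = 43 - 5 * sqrt 33"
    using bounds sqrt_bounds[of 5 33 "8"] sqrt_bounds[of 5 33 "6"] by simp
  moreover have "sqrt 3 ^ 4 = (9 :: real)"
    using power_mult[of "sqrt 3" 2 2] by simp
  ultimately have "R ^ 4 * 2 ^ 19 = 9 * (17 - sqrt 33) ^ 4 * (43 - 5 * sqrt 33)"
    by (simp add: assms power_mult_distrib power_divide)
  \<comment> \<open>This is conjugate to the radicand in \<open>R\<close>: the product of
    \<open>43 + 5 * sqrt 33\<close> and \<open>43 - 5 * sqrt 33\<close> is \<open>2^10\<close>. With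
    \<open>(17 - sqrt 33) (sqrt 33 + 1) = 16 (sqrt 33 - 1)\<close> this gives the fourth power of
    the required relation.\<close>
  moreover have "72 * y\<^sup>2 = 43 + 5 * sqrt 33"
    using roots by (simp add: y_eq power2_eq_square field_simps)
  moreover have "(sqrt 33)\<^sup>2 = (33 :: real)"
    by simp
  ultimately have "R ^ 4 * y\<^sup>2 * (sqrt 33 + 1) ^ 4 = 16 * (sqrt 33 - 1) ^ 4"
    by algebra
  then have "(R\<^sup>2 * y * (sqrt 33 + 1)\<^sup>2)\<^sup>2 = (4 * (sqrt 33 - 1)\<^sup>2)\<^sup>2"
    by (simp add: power_mult_distrib flip: power_mult)
  then have "R\<^sup>2 * y * (sqrt 33 + 1)\<^sup>2 = 4 * (sqrt 33 - 1)\<^sup>2"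
    by (rule power2_eq_imp_eq) (use R y in auto)
  then show "R * sqrt y * (sqrt 33 + 1) = 2 * (sqrt 33 - 1)"
    using R y by (intro ratio_from_square) simp_all
  show "elliptic_integral (4 * 12) (288 - 195 * sqrt 3 + 15 * sqrt 11) =
      sqrt 33 * elliptic_integral (- 4 * 12) (288 - 195 * sqrt 3 + 15 * sqrt 11)"
    if "elliptic_integrable (- 4 * 12) (288 - 195 * sqrt 3 + 15 * sqrt 11)"
    using isogeny_order33_first isogeny_order33_second that roots(1) by simp
qed auto

theorem mainTheorem5:
  fixes x y z R :: real
  assumes "x = -1" and "z = -y"
    and "(y, R) \<in>
      {(1/3, 2 * sqrt 3 * (2 - sqrt 3)),
       ((sqrt 5 - 1) / 2, 2 * sqrt (sqrt 5 - 2)),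
       (7/9, 2 * (4 - sqrt 7) / sqrt 7),
       (sqrt 3 / 2, sqrt 2 / root 4 3),
       ((5 * sqrt 13 - 1) / 18, 2 * sqrt (37 * sqrt 13 - 106) / 9),
       (3/121 * (21 + 8 * sqrt 5),
         2 * (sqrt 3 - 3 * sqrt 5) * (sqrt 5 - 4) / (3 * (1 + sqrt 15))),
       (4 * sqrt 5 / 9, 2 / root 4 5),
       (16 / (15 * sqrt 3 - 3 * sqrt 11),
         sqrt 3 * (17 - sqrt 33) * root 4 (43 - 5 * sqrt 33) / 2 powr (19/4))}"
  shows "H2 (of_real x) (of_real y) (of_real z) =
         of_real R * G (of_real x) (of_real y) (of_real z)"
  using assms(3) unfolding assms(1,2) insert_iff prod.inject empty_iff
  by (elim disjE conjE FalseE)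
    (rule H2_eq_G_order3 H2_eq_G_order5 H2_eq_G_order7 H2_eq_G_order9
      H2_eq_G_order13 H2_eq_G_order15 H2_eq_G_order25 H2_eq_G_order33; assumption)+

end
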